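(* Let $q=p^e>4$, where $p$ is a prime, and let $\ell$ be a positive integer with $2\ell\mid e$. Let $V$ be an $r$-dimensional $\mathbb F_p$-subspace of $\mathbb F_{p^\ell}$ with $0\le r<\ell$, let $m$ be a positive integer with $m\mid\frac{q-1}{p^\ell-1}$, let $1\le t\le p^{\ell-r}-1$, put $n=tmp^r$, and let $s\ge1$. Then, for every integer $k$ with $$s+1\le k\le\left\lfloor\frac{n+p^\ell}{p^\ell+1}\right\rfloor$$ and every integer $h$ with $0\le h\le k-s-1$, there exists an $[n+s,k]_q$ generalized Roth-Lempel code $C$ such that $\dim(\operatorname{Hull}_{\ell}(C))=h$.
   Context: For $q=p^e$ and $0\le\ell\le e-1$, the $\ell$-Galois inner product on $\mathbb F_q^N$ is $\langle\boldsymbol x,\boldsymbol y\rangle_\ell=\sum_i x_iy_i^{p^\ell}$. For a linear code $C\subseteq\mathbb F_q^N$, $C^{\perp_\ell}=\{\boldsymbol x\in\mathbb F_q^N:\langle\boldsymbol c,\boldsymbol x\rangle_\ell=0\ \text{for all }\boldsymbol c\in C\}$ and $\operatorname{Hull}_\ell(C)=C\cap C^{\perp_\ell}$. An $[n+s,k]_q$ generalized Roth-Lempel (GRL) code, where $1\le s\le k\le n$, is a code of the form $$\operatorname{GRL}_k(\boldsymbol a,\boldsymbol v,A_s)=\{(v_1f(a_1),\ldots,v_nf(a_n),(f_{k-s},\ldots,f_{k-1})A_s): f(x)=\textstyle\sum_{j=0}^{k-1}f_jx^j\in\mathbb F_q[x]\},$$ where $\boldsymbol a\in\mathbb F_q^n$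 has pairwise distinct entries, $\boldsymbol v\in(\mathbb F_q^* )^n$ and $A_s\in\operatorname{GL}_s(\mathbb F_q)$. *)

theory Defs
  imports
    "Jordan_Normal_Form.VS_Connect"
    "HOL-Algebra.Embedded_Algebras"
    "HOL-Computational_Algebra.Polynomial"
    "HOL-Library.Cardinality"
begin

text \<open>
  A finite field \<open>\<F>\<^sub>q\<close> with \<open>q = p ^ e\<close> is a type of sort \<open>{field, finite}\<close> of cardinality \<open>p ^ e\<close>;
  vectors of length \<open>N\<close> over it are the elements of \<open>carrier_vec N\<close>.
\<close>

definition galois_inner :: "nat \<Rightarrow> nat \<Rightarrow> 'a::field vec \<Rightarrow> 'a vec \<Rightarrow> 'a" where
  "galois_inner p l x y = (\<Sum>i<dim_vec y. x $ i * (y $ i) ^ (p ^ l))"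

definition galois_dual :: "nat \<Rightarrow> nat \<Rightarrow> nat \<Rightarrow> 'a::field vec set \<Rightarrow> 'a vec set" where
  "galois_dual p l N C = {x \<in> carrier_vec N. \<forall>c\<in>C. galois_inner p l c x = 0}"

definition galois_hull :: "nat \<Rightarrow> nat \<Rightarrow> nat \<Rightarrow> 'a::field vec set \<Rightarrow> 'a vec set" where
  "galois_hull p l N C = C \<inter> galois_dual p l N C"

text \<open>The dimension over \<open>'a\<close> of a subspace \<open>W\<close> of \<open>carrier_vec N\<close>.\<close>

definition code_dim :: "nat \<Rightarrow> 'a::field vec set \<Rightarrow> nat" where
  "code_dim N W = vectorspace.dim class_ring ((module_vec TYPE('a) N)\<lparr>carrier := W\<rparr>)"

text \<open>
  Here \<open>n = dim_vec a\<close> and \<open>s = dim_row A\<close>.  Vectors of \<open>Matrix\<close> are column vectors, so the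
  product of the row vector \<open>(f\<^bsub>k-s\<^esub>, \<dots>, f\<^bsub>k-1\<^esub>)\<close> with \<open>A\<close> is written with the transpose of \<open>A\<close>.
\<close>

definition GRL_code :: "nat \<Rightarrow> 'a::field vec \<Rightarrow> 'a vec \<Rightarrow> 'a mat \<Rightarrow> 'a vec set" where
  "GRL_code k a v A =
     {vec (dim_vec a) (\<lambda>i. v $ i * poly f (a $ i)) @\<^sub>v
      (transpose_mat A *\<^sub>v vec (dim_row A) (\<lambda>j. Polynomial.coeff f (k - dim_row A + j)))
      | f. Polynomial.degree f < k}"

definition is_GRL_code :: "nat \<Rightarrow> nat \<Rightarrow> nat \<Rightarrow> 'a::field vec set \<Rightarrow> bool" where
  "is_GRL_code n s k C \<longleftrightarrow>
     1 \<le> s \<and> s \<le> k \<and> k \<le> n \<and>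
     (\<exists>a v A. a \<in> carrier_vec n \<and> (\<forall>i<n. \<forall>j<n. i \<noteq> j \<longrightarrow> a $ i \<noteq> a $ j) \<and>
              v \<in> carrier_vec n \<and> (\<forall>i<n. v $ i \<noteq> 0) \<and>
              A \<in> carrier_mat s s \<and> invertible_mat A \<and>
              C = GRL_code k a v A)"

end

(* Let Q = p^l and let c be a weight on n nonzero points with values in the multiplicative group
   of F_Q whose power sums \<open>\<Sum> c(x) x^d\<close> vanish for 0 < d < n.  Since Q^2 - 1 divides q - 1, c(x) is a
   (Q+1)-st power, so it can be realised as v_i^(Q+1).  As k(Q+1) \<le> n + Q, the polynomial f g^Q has
   degree < n for deg f, deg g < k, and with A = 1 the l-Galois form becomes a nonzero multiple of
   f(0) g(0)^Q plus the sum of f_j g_j^Q over the top s coefficients; the hull has dimension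
   k - s - 1.  Multiplying v_i by some \<alpha> with \<alpha>^(Q+1) \<noteq> 1 at k - s - 1 - h of the points adds nonzero
   multiples of f(x) g(x)^Q at these points.  All the functionals involved are linearly
   independent, so the hull shrinks to the polynomials of degree < k - s divisible by X and by the
   X - x, which form a space of dimension h.

   The points are the roots x of x^m = w, for w in a set W of t p^r elements of F_Q^*.  Averaging
   over the m-th roots of unity kills the power sums with d not divisible by m, and for d = m d'
   Lagrange interpolation on W does, for the weight 1 / (w \<Prod> (w - w')) at w = x^m. *)
theory Submission
  imports Defs "HOL-Number_Theory.Residues"
begin

section \<open>Power maps and roots of unity in a finite field\<close>

lemma field_power_card_minus_1:
  fixes x :: "'a::{field,finite}"
  assumes "x \<noteq> 0"
  shows "x ^ (CARD('a) - 1) = 1"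
proof -
  have "(\<Prod>y\<in>UNIV-{0}. x * y) = (\<Prod>y\<in>UNIV-{0}. y)"
    by (rule prod.reindex_bij_witness[of _ "\<lambda>y. y / x" "\<lambda>y. x * y"]) (use assms in auto)
  moreover have "(\<Prod>y\<in>UNIV-{0}. x * y) = x ^ (CARD('a) - 1) * \<Prod>(UNIV-{0})"
    by (simp add: prod.distrib)
  moreover have "\<Prod>(UNIV-{0}) \<noteq> (0::'a)"
    by simp
  ultimately show ?thesis
    by simp
qed

lemma card_nth_roots_field_le:
  fixes y :: "'a::{field,finite}"
  assumes "n > 0"
  shows "card {x. x ^ n = y} \<le> n"
proof -
  let ?P = "Polynomial.monom 1 n - [:y:]"
  have deg: "Polynomial.degree ?P \<le> n"
    by (rule degree_diff_le) (auto simp: degree_monom_le)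
  have "Polynomial.coeff ?P n = 1"
    using assms by (cases n) auto
  hence nz: "?P \<noteq> 0"
    by (metis coeff_0 zero_neq_one)
  have "{x. x ^ n = y} = {x. poly ?P x = 0}"
    by (auto simp: poly_monom)
  thus ?thesis
    using card_poly_roots_bound[OF nz] deg by simp
qed

text \<open>A count that avoids cyclicity of the unit group: the fibres of \<open>x ^ m\<close> over
  the \<open>M\<close>-th roots of unity partition the \<open>m * M\<close> nonzero elements. There
  are at most \<open>M\<close> fibres with at most \<open>m\<close> elements each, so none of them
  can fall short of \<open>m\<close>.\<close>

lemma card_nth_roots_field_eq:
  fixes y :: "'a::{field,finite}"
  assumes mM: "m * M = CARD('a) - 1" and y: "y ^ M = 1"
  shows "card {x. x ^ m = y} = m"
proof (rule ccontr)
  assume neq: "card {x. x ^ m = y} \<noteq> m"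
  have "CARD('a) - 1 > 0"
    using card_mono[of UNIV "{0, 1::'a}"] by simp
  hence "m > 0" "M > 0"
    using mM by (auto intro: gr0I)
  define Y where "Y = {y::'a. y ^ M = 1}"
  have "UNIV - {0} = (\<Union>y\<in>Y. {x::'a. x ^ m = y})"
  proof (intro equalityI subsetI)
    fix x :: 'a assume "x \<in> UNIV - {0}"
    thus "x \<in> (\<Union>y\<in>Y. {x. x ^ m = y})"
      using field_power_card_minus_1[of x, folded mM] by (auto simp: Y_def simp flip: power_mult)
  next
    fix x :: 'a assume "x \<in> (\<Union>y\<in>Y. {x. x ^ m = y})"
    thus "x \<in> UNIV - {0}"
      using \<open>m > 0\<close> \<open>M > 0\<close> by (auto simp: Y_def power_0_left)
  qed
  hence "CARD('a) - 1 = card (\<Union>y\<in>Y. {x::'a. x ^ m = y})"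
    by (metis card_Diff_singleton UNIV_I)
  also have "\<dots> = (\<Sum>y\<in>Y. card {x::'a. x ^ m = y})"
    by (rule card_UN_disjoint) auto
  also have "\<dots> < (\<Sum>y\<in>Y. m)"
  proof (rule sum_strict_mono_ex1)
    have "card {x. x ^ m = y} < m"
      using neq card_nth_roots_field_le[OF \<open>m > 0\<close>, of y] by linarith
    thus "\<exists>y\<in>Y. card {x. x ^ m = y} < m"
      using y by (auto simp: Y_def)
  qed (use card_nth_roots_field_le[OF \<open>m > 0\<close>] in auto)
  also have "\<dots> \<le> m * M"
    using card_nth_roots_field_le[OF \<open>M > 0\<close>, of "1::'a"] by (simp add: Y_def)
  finally show False
    using mM by simp
qed

section \<open>Polynomials with prescribed roots, interpolation and vanishing power sums\<close>

lemma degree_prod_root_factors: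
  "Polynomial.degree (\<Prod>z\<in>Z. [:- z, 1:] :: 'a::field poly) = card Z"
  by (subst degree_prod_eq_sum_degree) auto

lemma poly_prod_root_factors_eq_0_iff:
  fixes x :: "'a::field"
  assumes "finite Z"
  shows "poly (\<Prod>z\<in>Z. [:- z, 1:]) x = 0 \<longleftrightarrow> x \<in> Z"
  using assms by (auto simp: poly_prod)

lemma prod_root_factors_dvd:
  fixes g :: "'a::field poly"
  assumes "finite Z" "\<And>z. z \<in> Z \<Longrightarrow> poly g z = 0"
  shows "(\<Prod>z\<in>Z. [:- z, 1:]) dvd g"
  using assms
proof (induction Z)
  case (insert z Z)
  then obtain r where r: "g = (\<Prod>z\<in>Z. [:- z, 1:]) * r"
    by (auto elim: dvdE)
  have "poly r z = 0"
    using insert poly_prod_root_factors_eq_0_iff[of Z z] r by auto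
  thus ?case
    using insert.hyps r by (simp add: poly_eq_0_iff_dvd mult_dvd_mono mult.commute del: mult_pCons_left)
qed auto

lemma poly_eq_if_agree_on:
  fixes f g :: "'a::field poly"
  assumes "finite S" "Polynomial.degree f < card S" "Polynomial.degree g < card S"
    and "\<And>x. x \<in> S \<Longrightarrow> poly f x = poly g x"
  shows "f = g"
proof (rule ccontr)
  assume "f \<noteq> g"
  hence nz: "f - g \<noteq> 0" by simp
  have "card S \<le> card {x. poly (f - g) x = 0}"
    using assms by (intro card_mono poly_roots_finite nz) auto
  also have "\<dots> \<le> Polynomial.degree (f - g)"
    by (rule card_poly_roots_bound[OF nz])
  also have "\<dots> < card S"
    using assms degree_diff_less by blast
  finally show False by simp
qed

text \<open>The sum is the coefficient at \<open>card W - 1\<close> of the Lagrange interpolant of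
  \<open>X^d\<close> on \<open>W\<close>. That interpolant is \<open>X^d\<close> itself, whose
  degree is smaller.\<close>

lemma lagrange_sum_power_eq_0:
  fixes W :: "'a::field set"
  assumes fin: "finite W" and d: "Suc d < card W"
  shows "(\<Sum>w\<in>W. w ^ d / (\<Prod>w'\<in>W - {w}. w - w')) = 0"
proof -
  define L where "L w = (\<Prod>w'\<in>W - {w}. [:- w', 1:])" for w
  define u where "u w = w ^ d / (\<Prod>w'\<in>W - {w}. w - w')" for w
  have degL: "Polynomial.degree (L w) = card W - 1" if "w \<in> W" for w
    unfolding L_def degree_prod_root_factors using fin that by simp
  have lcL: "Polynomial.coeff (L w) (card W - 1) = 1" if "w \<in> W" for w
    using lead_coeff_prod[of "\<lambda>w'. [:- w', 1:]" "W - {w}"] degL[OF that] by (simp add: L_def)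
  have polyL: "poly (L w) x = (\<Prod>w'\<in>W - {w}. x - w')" for w x
    by (simp add: L_def poly_prod)
  have "(\<Sum>w\<in>W. Polynomial.smult (u w) (L w)) = Polynomial.monom 1 d"
  proof (rule poly_eq_if_agree_on[OF fin])
    show "Polynomial.degree (\<Sum>w\<in>W. Polynomial.smult (u w) (L w)) < card W"
      using d degL by (intro le_less_trans[OF degree_sum_le[of W _ "card W - 1"]] fin)
        (auto intro: order.trans[OF degree_smult_le])
    show "Polynomial.degree (Polynomial.monom (1::'a) d) < card W"
      using d by (simp add: degree_monom_eq)
    fix x assume x: "x \<in> W"
    have "poly (\<Sum>w\<in>W. Polynomial.smult (u w) (L w)) x = (\<Sum>w\<in>W. u w * poly (L w) x)"
      by (simp add: poly_sum)
    also have "\<dots> = (\<Sum>w\<in>{x}. u w * poly (L w) x)"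
      using fin x by (intro sum.mono_neutral_right) (auto simp: polyL)
    also have "\<dots> = x ^ d"
      using fin by (simp add: u_def polyL)
    finally show "poly (\<Sum>w\<in>W. Polynomial.smult (u w) (L w)) x = poly (Polynomial.monom 1 d) x"
      by (simp add: poly_monom)
  qed
  \<comment> \<open>Each \<open>L w\<close> is monic of degree \<open>card W - 1\<close>, so this
    coefficient is the sum of the \<open>u w\<close>.\<close>
  hence "Polynomial.coeff (\<Sum>w\<in>W. Polynomial.smult (u w) (L w)) (card W - 1) = 0"
    using d by simp
  thus ?thesis
    using lcL by (simp add: Polynomial.coeff_sum u_def)
qed

text \<open>Replacing \<open>x\<close> by \<open>z * x\<close> with \<open>z ^ m = 1\<close>
  permutes the index set and preserves \<open>c (x ^ m)\<close>, but multiplies the sum by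
  \<open>z ^ d\<close>. It remains to find such a \<open>z\<close> with
  \<open>z ^ d \<noteq> 1\<close>.\<close>

lemma sum_power_fibres_eq_0:
  fixes c :: "'a::{field,finite} \<Rightarrow> 'a"
  assumes m: "m dvd CARD('a) - 1" and d: "\<not> m dvd d"
  shows "(\<Sum>x | x ^ m \<in> W. c (x ^ m) * x ^ d) = 0"
proof -
  have "CARD('a) - 1 > 0"
    using card_mono[of UNIV "{0, 1::'a}"] by simp
  hence "m > 0"
    using m by (auto intro: gr0I)
  obtain M where M: "m * M = CARD('a) - 1"
    using m by (metis dvdE)
  have roots: "card {x::'a. x ^ m = 1} = m"
    by (rule card_nth_roots_field_eq[OF M]) simp
  let ?d = "d mod m"
  have "?d > 0"
    using d by (auto simp: dvd_eq_mod_eq_0)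
  \<comment> \<open>There are \<open>m\<close> roots of \<open>z ^ m = 1\<close>, more than the
    equation with exponent \<open>d mod m\<close> can have.\<close>
  have "\<exists>z::'a. z ^ m = 1 \<and> z ^ ?d \<noteq> 1"
  proof (rule ccontr)
    assume "\<not> ?thesis"
    hence "m \<le> card {x::'a. x ^ ?d = 1}"
      by (subst roots[symmetric], intro card_mono) auto
    also have "\<dots> \<le> ?d"
      by (rule card_nth_roots_field_le) fact
    also have "\<dots> < m"
      using \<open>m > 0\<close> by simp
    finally show False by simp
  qed
  then obtain z :: 'a where z: "z ^ m = 1" "z ^ ?d \<noteq> 1"
    by auto
  have "z \<noteq> 0"
    using z \<open>m > 0\<close> by (auto simp: power_0_left)
  have "z ^ d = (z ^ m) ^ (d div m) * z ^ ?d"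
    by (simp flip: power_mult power_add)
  hence zd: "z ^ d \<noteq> 1"
    using z by simp
  have "(\<Sum>x | x ^ m \<in> W. c (x ^ m) * x ^ d) = (\<Sum>x | x ^ m \<in> W. c ((z * x) ^ m) * (z * x) ^ d)"
    by (rule sum.reindex_bij_witness[of _ "\<lambda>x. z * x" "\<lambda>x. x / z"])
       (use z \<open>z \<noteq> 0\<close> in \<open>auto simp: power_mult_distrib power_divide\<close>)
  also have "\<dots> = z ^ d * (\<Sum>x | x ^ m \<in> W. c (x ^ m) * x ^ d)"
    using z by (simp add: power_mult_distrib sum_distrib_left mult_ac)
  finally show ?thesis
    using zd by simp
qed

section \<open>Codewords, the Galois form and the dimension of the hull\<close>

text \<open>Rank-nullity with zero kernel. The hull is later written as such an image, so no basis
  of it has to be exhibited.\<close>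

lemma code_dim_inj_linear_image:
  fixes T :: "'a::field vec \<Rightarrow> 'a vec"
  assumes carr: "T \<in> carrier_vec h \<rightarrow> carrier_vec N"
    and add: "\<And>u w. u \<in> carrier_vec h \<Longrightarrow> w \<in> carrier_vec h \<Longrightarrow> T (u + w) = T u + T w"
    and smult: "\<And>c u. u \<in> carrier_vec h \<Longrightarrow> T (c \<cdot>\<^sub>v u) = c \<cdot>\<^sub>v T u"
    and inj: "inj_on T (carrier_vec h)"
  shows "code_dim N (T ` carrier_vec h) = h"
proof -
  let ?U = "module_vec TYPE('a) h" and ?W = "module_vec TYPE('a) N"
  have "T \<in> LinearCombinations.module_hom class_ring ?U ?W"
    using carr add smult
    by (auto simp: LinearCombinations.module_hom_def module_vec_simps class_ring_simps)
  then have lin: "linear_map class_ring ?U ?W T"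
    by (intro linear_map.intro mod_hom.intro mod_hom_axioms.intro vec_vs vec_module)
  have dim: "vectorspace.fin_dim class_ring ?U" "vectorspace.dim class_ring ?U = h"
    using vec_space.fin_dim vec_space.dim_is_n by blast+
  have inj': "inj_on T (carrier ?U)"
    using inj by (simp only: module_vec_simps)
  have "mod_hom class_ring ?U ?W T"
    using lin by (simp add: linear_map_def)
  hence im: "mod_hom.im ?U T = T ` carrier_vec h"
    by (simp only: mod_hom.im_def module_vec_simps)
  show ?thesis
    using linear_map.rank_nullity[OF lin dim(1)] linear_map.inj_imp_dim_ker0[OF lin inj']
    by (simp only: im dim code_dim_def)
qed

text \<open>The encoder when the matrix \<open>A\<close> is the identity, kept as a function of the
  polynomial so that its linearity and injectivity can be stated.\<close>

definition grl_word :: "nat \<Rightarrow> nat \<Rightarrow> 'a::field vec \<Rightarrow> 'a vec \<Rightarrow> 'a poly \<Rightarrow> 'a vec" where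
  "grl_word s k a v f =
     vec (dim_vec a) (\<lambda>i. v $ i * poly f (a $ i)) @\<^sub>v vec s (\<lambda>j. Polynomial.coeff f (k - s + j))"

lemma GRL_code_one_mat:
  "GRL_code k a v (1\<^sub>m s) = {grl_word s k a v f | f. Polynomial.degree f < k}"
  by (simp add: GRL_code_def grl_word_def)

lemma grl_word_carrier: "a \<in> carrier_vec n \<Longrightarrow> grl_word s k a v f \<in> carrier_vec (n + s)"
  by (auto simp: grl_word_def)

lemma grl_word_add: "grl_word s k a v (f + g) = grl_word s k a v f + grl_word s k a v g"
  by (intro eq_vecI) (auto simp: grl_word_def algebra_simps)

lemma grl_word_smult: "grl_word s k a v (Polynomial.smult c f) = c \<cdot>\<^sub>v grl_word s k a v f"
  by (intro eq_vecI) (auto simp: grl_word_def algebra_simps)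

lemma sum_lessThan_add_split:
  fixes f :: "nat \<Rightarrow> 'a::comm_monoid_add"
  shows "(\<Sum>i<n + s. f i) = (\<Sum>i<n. f i) + (\<Sum>j<s. f (n + j))"
  by (induction s) (auto simp: add_ac)

lemma galois_inner_grl_word:
  assumes "a \<in> carrier_vec n"
  shows "galois_inner p l (grl_word s k a v f) (grl_word s k a v g) =
    (\<Sum>i<n. (v $ i) ^ (p ^ l + 1) * (poly f (a $ i) * poly g (a $ i) ^ (p ^ l))) +
    (\<Sum>j<s. Polynomial.coeff f (k - s + j) * Polynomial.coeff g (k - s + j) ^ (p ^ l))"
proof -
  have "dim_vec (grl_word s k a v g) = n + s"
    using assms by (auto simp: grl_word_def)
  thus ?thesis
    unfolding galois_inner_def using assms
    by (simp add: sum_lessThan_add_split grl_word_def power_mult_distrib mult_ac)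
qed

lemma grl_word_inj:
  assumes "a \<in> carrier_vec n" "inj_on (\<lambda>i. a $ i) {..<n}" "\<And>i. i < n \<Longrightarrow> v $ i \<noteq> 0"
    and "Polynomial.degree f < n" "Polynomial.degree g < n"
    and eq: "grl_word s k a v f = grl_word s k a v g"
  shows "f = g"
proof (rule poly_eq_if_agree_on)
  have card: "card ((\<lambda>i. a $ i) ` {..<n}) = n"
    using assms by (simp add: card_image)
  show "Polynomial.degree f < card ((\<lambda>i. a $ i) ` {..<n})" "Polynomial.degree g < card ((\<lambda>i. a $ i) ` {..<n})"
    using card assms by auto
  fix x assume "x \<in> (\<lambda>i. a $ i) ` {..<n}"
  then obtain i where i: "i < n" "x = a $ i" by auto
  have "grl_word s k a v f $ i = grl_word s k a v g $ i"
    using eq by simp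
  thus "poly f x = poly g x"
    using i assms by (simp add: grl_word_def)
qed auto

text \<open>By \<open>form\<close>, the Galois form is diagonal in the evaluations at
  \<open>Z\<close> and the top \<open>s\<close> coefficients. As \<open>card Z \<le> k - s\<close>,
  these functionals are linearly independent on polynomials of degree below \<open>k\<close>, so the
  radical of the form is their common kernel.\<close>

lemma galois_hull_GRL_one:
  fixes a v :: "'a::field vec" and Z :: "'a set"
  assumes p: "p > 0" and sk: "s \<le> k" and a: "a \<in> carrier_vec n"
    and Z: "finite Z" "card Z \<le> k - s" "\<And>z. z \<in> Z \<Longrightarrow> d z \<noteq> 0"
    and form: "\<And>f g. Polynomial.degree f < k \<Longrightarrow> Polynomial.degree g < k \<Longrightarrow>
      (\<Sum>i<n. (v $ i) ^ (p ^ l + 1) * (poly f (a $ i) * poly g (a $ i) ^ (p ^ l))) =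
      (\<Sum>z\<in>Z. d z * (poly f z * poly g z ^ (p ^ l)))"
  shows "galois_hull p l (n + s) (GRL_code k a v (1\<^sub>m s)) =
    {grl_word s k a v g | g. Polynomial.degree g < k \<and> (\<forall>j<s. Polynomial.coeff g (k - s + j) = 0)
       \<and> (\<forall>z\<in>Z. poly g z = 0)}"
proof -
  have inner: "galois_inner p l (grl_word s k a v f) (grl_word s k a v g) =
      (\<Sum>z\<in>Z. d z * (poly f z * poly g z ^ (p ^ l))) +
      (\<Sum>j<s. Polynomial.coeff f (k - s + j) * Polynomial.coeff g (k - s + j) ^ (p ^ l))"
    if "Polynomial.degree f < k" "Polynomial.degree g < k" for f g
    by (simp only: galois_inner_grl_word[OF a] form[OF that])
  have radical: "(\<forall>f. Polynomial.degree f < k \<longrightarrow>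
           galois_inner p l (grl_word s k a v f) (grl_word s k a v g) = 0) \<longleftrightarrow>
        (\<forall>j<s. Polynomial.coeff g (k - s + j) = 0) \<and> (\<forall>z\<in>Z. poly g z = 0)"
    (is "?L \<longleftrightarrow> ?R") if g: "Polynomial.degree g < k" for g
  proof
    assume ?R
    thus ?L
      using p by (auto simp: inner[OF _ g] power_0_left)
  next
    assume L: ?L
    have L': "(\<Sum>z\<in>Z. d z * (poly f z * poly g z ^ (p ^ l))) +
       (\<Sum>j<s. Polynomial.coeff f (k - s + j) * Polynomial.coeff g (k - s + j) ^ (p ^ l)) = 0"
      if "Polynomial.degree f < k" for f
      using L that inner[OF that g] by simp
    have gZ: "poly g z = 0" if z: "z \<in> Z" for z
    proof -
      \<comment> \<open>This \<open>f\<close> vanishes on the rest of \<open>Z\<close>, and its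
        degree \<open>card Z - 1\<close> is below \<open>k - s\<close>, so the coefficient part of
        the form drops out and only the term at \<open>z\<close> is left.\<close>
      define f where "f = (\<Prod>y\<in>Z - {z}. [:- y, 1:])"
      have "card Z > 0"
        using z Z by (auto simp: card_gt_0_iff)
      hence deg: "Polynomial.degree f < k - s"
        using z Z unfolding f_def degree_prod_root_factors by simp
      have fz: "poly f z \<noteq> 0"
        using Z by (simp add: f_def poly_prod)
      have "(\<Sum>j<s. Polynomial.coeff f (k - s + j) * Polynomial.coeff g (k - s + j) ^ (p ^ l)) = 0"
        using deg by (intro sum.neutral) (auto simp: Polynomial.coeff_eq_0)
      hence "0 = (\<Sum>y\<in>Z. d y * (poly f y * poly g y ^ (p ^ l)))"
        using L'[of f] deg by simp
      also have "\<dots> = (\<Sum>y\<in>{z}. d y * (poly f y * poly g y ^ (p ^ l)))"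
        using Z z by (intro sum.mono_neutral_right) (auto simp: f_def poly_prod)
      finally show ?thesis
        using Z z fz by simp
    qed
    have "Polynomial.coeff g (k - s + j) = 0" if j: "j < s" for j
    proof -
      \<comment> \<open>The monomial may be nonzero on \<open>Z\<close>, but the evaluation terms
        vanish because \<open>gZ\<close> is already known.\<close>
      let ?f = "Polynomial.monom (1::'a) (k - s + j)"
      have "0 = (\<Sum>i<s. Polynomial.coeff ?f (k - s + i) * Polynomial.coeff g (k - s + i) ^ (p ^ l))"
        using L'[of ?f] gZ p j sk by (simp add: degree_monom_eq)
      also have "\<dots> = (\<Sum>i<s. if j = i then Polynomial.coeff g (k - s + i) ^ (p ^ l) else 0)"
        by (intro sum.cong) auto
      also have "\<dots> = Polynomial.coeff g (k - s + j) ^ (p ^ l)"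
        using j by simp
      finally show ?thesis
        by simp
    qed
    with gZ show ?R by auto
  qed
  have "grl_word s k a v g \<in> galois_dual p l (n + s) (GRL_code k a v (1\<^sub>m s)) \<longleftrightarrow>
      (\<forall>j<s. Polynomial.coeff g (k - s + j) = 0) \<and> (\<forall>z\<in>Z. poly g z = 0)"
    if "Polynomial.degree g < k" for g
    unfolding radical[OF that, symmetric] galois_dual_def GRL_code_one_mat
    using grl_word_carrier[OF a] by blast
  thus ?thesis
    unfolding galois_hull_def by (auto simp only: GRL_code_one_mat)
qed

text \<open>Polynomials of degree below \<open>k - s\<close> vanishing on \<open>Z\<close> are the
  multiples \<open>P * B\<close> of the root product \<open>P\<close> with \<open>B\<close> of
  degree below \<open>h\<close>, since \<open>card Z + h = k - s\<close>. The coefficients of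
  \<open>B\<close> are free, which gives dimension \<open>h\<close>.\<close>

lemma code_dim_galois_hull_GRL_one:
  fixes a v :: "'a::field vec" and Z :: "'a set"
  assumes p: "p > 0" and sk: "1 \<le> k" "s \<le> k" "k \<le> n" and a: "a \<in> carrier_vec n"
    and inj: "inj_on (\<lambda>i. a $ i) {..<n}" and v: "\<And>i. i < n \<Longrightarrow> v $ i \<noteq> 0"
    and Z: "finite Z" "card Z + h = k - s" "\<And>z. z \<in> Z \<Longrightarrow> d z \<noteq> 0"
    and form: "\<And>f g. Polynomial.degree f < k \<Longrightarrow> Polynomial.degree g < k \<Longrightarrow>
      (\<Sum>i<n. (v $ i) ^ (p ^ l + 1) * (poly f (a $ i) * poly g (a $ i) ^ (p ^ l))) =
      (\<Sum>z\<in>Z. d z * (poly f z * poly g z ^ (p ^ l)))"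
  shows "code_dim (n + s) (galois_hull p l (n + s) (GRL_code k a v (1\<^sub>m s))) = h"
proof -
  define B where "B u = (\<Sum>j<h. Polynomial.monom (u $ j) j)" for u :: "'a vec"
  define P where "P = (\<Prod>z\<in>Z. [:- z, 1:])"
  define T where "T u = grl_word s k a v (P * B u)" for u
  have coeff_B: "Polynomial.coeff (B u) i = (if i < h then u $ i else 0)" for u i
    by (simp add: B_def Polynomial.coeff_sum)
  have "P \<noteq> 0"
    using Z by (auto simp: P_def)
  have degP: "Polynomial.degree P = card Z"
    unfolding P_def by (rule degree_prod_root_factors)
  \<comment> \<open>Stated through coefficients because the zero polynomial has degree 0, which is
    not below \<open>k - s\<close> when \<open>k = s\<close>.\<close>
  have coeff_PB: "Polynomial.coeff (P * B u) i = 0" if "k - s \<le> i" for u i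
  proof (cases "B u = 0")
    case False
    have "Polynomial.degree (B u) < h"
    proof (rule ccontr)
      assume "\<not> Polynomial.degree (B u) < h"
      hence "Polynomial.coeff (B u) (Polynomial.degree (B u)) = 0"
        by (simp add: coeff_B)
      thus False using False by simp
    qed
    thus ?thesis
      using that \<open>P \<noteq> 0\<close> False degP Z(2) by (intro Polynomial.coeff_eq_0) (simp add: degree_mult_eq)
  qed simp
  have deg_PB: "Polynomial.degree (P * B u) < k" for u
  proof (cases "P * B u = 0")
    case False
    hence "Polynomial.coeff (P * B u) (Polynomial.degree (P * B u)) \<noteq> 0"
      by simp
    hence "Polynomial.degree (P * B u) < k - s"
      using coeff_PB[of "Polynomial.degree (P * B u)" u] by (rule_tac ccontr) simp
    thus ?thesis by simp
  next
    case True
    hence "Polynomial.degree (P * B u) = 0"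
      by (simp only: Polynomial.degree_0)
    thus ?thesis
      using sk by linarith
  qed
  have "galois_hull p l (n + s) (GRL_code k a v (1\<^sub>m s)) = T ` carrier_vec h"
  proof (subst galois_hull_GRL_one[OF p sk(2) a Z(1) _ Z(3) form])
    show "card Z \<le> k - s" using Z by simp
    show "{grl_word s k a v g | g. Polynomial.degree g < k \<and> (\<forall>j<s. Polynomial.coeff g (k - s + j) = 0)
       \<and> (\<forall>z\<in>Z. poly g z = 0)} = T ` carrier_vec h" (is "?A = ?B")
    proof (intro equalityI subsetI)
      fix x assume "x \<in> ?A"
      then obtain g where g: "x = grl_word s k a v g" "Polynomial.degree g < k"
        "\<And>j. j < s \<Longrightarrow> Polynomial.coeff g (k - s + j) = 0" "\<And>z. z \<in> Z \<Longrightarrow> poly g z = 0"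
        by auto
      have "P dvd g"
        unfolding P_def using Z g by (intro prod_root_factors_dvd) auto
      then obtain q where q: "g = P * q" by auto
      have coeff_q: "Polynomial.coeff q i = 0" if "i \<ge> h" for i
      proof (cases "q = 0")
        case False
        have "Polynomial.degree q < h"
        proof (rule ccontr)
          assume "\<not> Polynomial.degree q < h"
          hence *: "Polynomial.degree g \<ge> k - s"
            using Z(2) False \<open>P \<noteq> 0\<close> degP by (simp add: q degree_mult_eq)
          \<comment> \<open>The index is the degree of \<open>g\<close> in disguise, so the leading
            coefficient of \<open>g\<close> is among those that vanish.\<close>
          have "Polynomial.coeff g (k - s + (Polynomial.degree g - (k - s))) = 0"
            by (rule g(3)) (use * g(2) sk in linarith)
          hence "g = 0"
            using * by simp
          thus False using q False \<open>P \<noteq> 0\<close> by simp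
        qed
        thus ?thesis using that by (simp add: Polynomial.coeff_eq_0)
      qed simp
      have "B (vec h (Polynomial.coeff q)) = q"
        by (intro poly_eqI) (auto simp: coeff_B coeff_q)
      hence "x = T (vec h (Polynomial.coeff q))"
        by (simp add: T_def g q)
      thus "x \<in> ?B" by auto
    next
      fix x assume "x \<in> ?B"
      then obtain u where "x = grl_word s k a v (P * B u)"
        by (auto simp: T_def)
      moreover have "poly (P * B u) z = 0" if "z \<in> Z" for z
        using that Z by (auto simp: P_def poly_prod)
      ultimately show "x \<in> ?A"
        using coeff_PB deg_PB by auto
    qed
  qed
  moreover have "code_dim (n + s) (T ` carrier_vec h) = h"
  proof (rule code_dim_inj_linear_image)
    show "T \<in> carrier_vec h \<rightarrow> carrier_vec (n + s)"
      using grl_word_carrier[OF a] by (auto simp: T_def)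
    show "T (u + w) = T u + T w" if "u \<in> carrier_vec h" "w \<in> carrier_vec h" for u w
    proof -
      have "B (u + w) = B u + B w"
        using that by (intro poly_eqI) (auto simp: coeff_B)
      thus ?thesis by (simp add: T_def distrib_left grl_word_add)
    qed
    show "T (c \<cdot>\<^sub>v u) = c \<cdot>\<^sub>v T u" if "u \<in> carrier_vec h" for c u
    proof -
      have "B (c \<cdot>\<^sub>v u) = Polynomial.smult c (B u)"
        using that by (intro poly_eqI) (auto simp: coeff_B)
      thus ?thesis by (simp add: T_def grl_word_smult)
    qed
    show "inj_on T (carrier_vec h)"
    proof (rule inj_onI)
      fix u w assume u: "u \<in> carrier_vec h" and w: "w \<in> carrier_vec h" and "T u = T w"
      hence "P * B u = P * B w"
        using grl_word_inj[OF a inj v, of "P * B u" "P * B w"] deg_PB sk(3) less_le_trans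
        unfolding T_def by blast
      hence "B u = B w" using \<open>P \<noteq> 0\<close> by simp
      hence "u $ i = w $ i" if "i < h" for i
        using coeff_B[of u i] coeff_B[of w i] that by simp
      thus "u = w" using u w by (intro eq_vecI) auto
    qed
  qed
  ultimately show ?thesis by simp
qed

section \<open>Points and subfield weights with vanishing power sums\<close>

text \<open>The subfield of order \<open>Q\<close> enters only through its equations: nonzero
  members satisfy \<open>x ^ (Q - 1) = 1\<close>, and \<open>frob\<close> makes the solutions of
  \<open>x ^ Q = x\<close> closed under differences. The points are the \<open>m\<close>-th roots of
  \<open>N\<close> such elements, with weights depending on \<open>x ^ m\<close> alone.\<close>

lemma exists_points_with_subfield_weights:
  fixes Q m N :: nat
  assumes Q: "Q \<ge> 2" "Q - 1 dvd CARD('a::{field,finite}) - 1"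
    and frob: "\<And>x y::'a::{field,finite}. (x - y) ^ Q = x ^ Q - y ^ Q"
    and m: "m dvd (CARD('a::{field,finite}) - 1) div (Q - 1)" and N: "N \<le> Q - 1"
  obtains S :: "'a::{field,finite} set" and c :: "'a \<Rightarrow> 'a" where "0 \<notin> S" "card S = m * N" "\<And>x. x \<in> S \<Longrightarrow> c x ^ (Q - 1) = 1"
    "\<And>d. 0 < d \<Longrightarrow> d < m * N \<Longrightarrow> (\<Sum>x\<in>S. c x * x ^ d) = 0"
proof -
  obtain j where j: "(CARD('a) - 1) div (Q - 1) = m * j"
    using m by (metis dvdE)
  have M: "m * ((Q - 1) * j) = CARD('a) - 1"
    using Q(2) j by (metis dvd_mult_div_cancel mult.left_commute)
  have "CARD('a) - 1 > 0"
    using card_mono[of UNIV "{0, 1::'a}"] by simp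
  hence "m > 0"
    using M by (metis gr0I mult_0 less_not_refl)
  have "card {w::'a. w ^ (Q - 1) = 1} = Q - 1"
    by (rule card_nth_roots_field_eq[of _ "(CARD('a) - 1) div (Q - 1)"]) (use Q in auto)
  then obtain W :: "'a set" where W: "W \<subseteq> {w. w ^ (Q - 1) = 1}" "card W = N"
    using N by (metis obtain_subset_with_card_n)
  have nz: "w \<noteq> 0" if "w \<in> W" for w
    using that W Q by (auto simp: power_0_left)
  have pow_Q: "x ^ Q = x * x ^ (Q - 1)" for x :: 'a
    using Q by (cases Q) auto
  have fixed: "w ^ Q = w" if "w \<in> W" for w
    using that W by (auto simp: pow_Q)
  \<comment> \<open>The extra factor \<open>w\<close> lowers exponents by one:
    \<open>u w * w ^ d'\<close> becomes a Lagrange term with exponent \<open>d' - 1\<close>, so the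
    range \<open>0 < d' < N\<close> is exactly what interpolation on \<open>N\<close> points
    covers.\<close>
  define u where "u w = 1 / (w * (\<Prod>w'\<in>W - {w}. w - w'))" for w
  have u_nz: "u w \<noteq> 0" if "w \<in> W" for w
    using nz[OF that] by (auto simp: u_def)
  have u_fixed: "u w ^ (Q - 1) = 1" if "w \<in> W" for w
  proof -
    \<comment> \<open>The \<open>Q\<close>-th power map fixes all elements of \<open>W\<close>,
      hence their differences and \<open>u w\<close>; a nonzero fixed element has
      \<open>(Q - 1)\<close>-th power 1.\<close>
    have "(\<Prod>w'\<in>W - {w}. w - w') ^ Q = (\<Prod>w'\<in>W - {w}. w - w')"
      unfolding prod_power_distrib
      using fixed that by (intro prod.cong) (auto simp: frob)
    hence "u w ^ Q = u w"
      using fixed[OF that] by (simp add: u_def power_divide power_mult_distrib)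
    thus ?thesis
      using u_nz[OF that] by (simp add: pow_Q)
  qed
  define S where "S = {x. x ^ m \<in> W}"
  have fibre: "card {x. x ^ m = w} = m" if "w \<in> W" for w
    by (rule card_nth_roots_field_eq[OF M]) (use that W in \<open>auto simp: power_mult\<close>)
  have S_UN: "S = (\<Union>w\<in>W. {x. x ^ m = w})"
    by (auto simp: S_def)
  have "card S = m * N"
    unfolding S_UN using fibre W(2) by (subst card_UN_disjoint) auto
  moreover have "(\<Sum>x\<in>S. u (x ^ m) * x ^ d) = 0" if d: "0 < d" "d < m * N" for d
  proof (cases "m dvd d")
    case False
    moreover have "m dvd CARD('a) - 1"
      using M by (metis dvd_triv_left)
    ultimately show ?thesis
      unfolding S_def by (intro sum_power_fibres_eq_0)
  next
    case True
    then obtain d' where d': "d = m * d'" by auto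
    have d'_bounds: "d' > 0" "d' < N"
      using d by (auto simp: d' intro: gr0I)
    \<comment> \<open>For \<open>d = m * d'\<close> the summand is constant on each fibre of
      \<open>x ^ m\<close>, so every \<open>w\<close> contributes \<open>m\<close> equal
      terms.\<close>
    have "(\<Sum>x\<in>S. u (x ^ m) * x ^ d) = (\<Sum>w\<in>W. \<Sum>x | x \<in> S \<and> x ^ m = w. u (x ^ m) * x ^ d)"
      by (rule sum.group[symmetric]) (auto simp: S_def)
    also have "\<dots> = (\<Sum>w\<in>W. of_nat m * (w ^ (d' - 1) / (\<Prod>w'\<in>W - {w}. w - w')))"
    proof (intro sum.cong refl)
      fix w assume w: "w \<in> W"
      have "(\<Sum>x | x \<in> S \<and> x ^ m = w. u (x ^ m) * x ^ d) = (\<Sum>x | x ^ m = w. u w * w ^ d')"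
        by (rule sum.cong) (use w in \<open>auto simp: S_def d' power_mult\<close>)
      also have "\<dots> = of_nat m * (u w * w ^ d')"
        using fibre[OF w] by simp
      also have "u w * w ^ d' = w ^ (d' - 1) / (\<Prod>w'\<in>W - {w}. w - w')"
        using d'_bounds nz[OF w] by (cases d') (auto simp: u_def)
      finally show "(\<Sum>x | x \<in> S \<and> x ^ m = w. u (x ^ m) * x ^ d) =
          of_nat m * (w ^ (d' - 1) / (\<Prod>w'\<in>W - {w}. w - w'))" .
    qed
    also have "\<dots> = of_nat m * (\<Sum>w\<in>W. w ^ (d' - 1) / (\<Prod>w'\<in>W - {w}. w - w'))"
      by (simp only: sum_distrib_left)
    also have "\<dots> = 0"
      using lagrange_sum_power_eq_0[of W "d' - 1"] d'_bounds W(2) by simp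
    finally show ?thesis .
  qed
  moreover have "0 \<notin> S"
    using nz \<open>m > 0\<close> by (auto simp: S_def power_0_left)
  moreover have "u (x ^ m) ^ (Q - 1) = 1" if "x \<in> S" for x
    using that u_fixed by (auto simp: S_def)
  ultimately show thesis
    by (rule_tac that[of S "\<lambda>x. u (x ^ m)"]) auto
qed

text \<open>Expanding \<open>F\<close> in monomials, every power sum with positive exponent vanishes
  and only the constant term is left.\<close>

lemma sum_weights_poly:
  fixes c :: "'a::field \<Rightarrow> 'a"
  assumes moments: "\<And>d. 0 < d \<Longrightarrow> d < n \<Longrightarrow> (\<Sum>x\<in>S. c x * x ^ d) = 0"
    and F: "Polynomial.degree F < n"
  shows "(\<Sum>x\<in>S. c x * poly F x) = (\<Sum>x\<in>S. c x) * poly F 0"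
proof -
  have "(\<Sum>x\<in>S. c x * poly F x) =
      (\<Sum>x\<in>S. \<Sum>i\<le>Polynomial.degree F. Polynomial.coeff F i * (c x * x ^ i))"
    by (simp add: poly_altdef sum_distrib_left mult_ac)
  also have "\<dots> = (\<Sum>i\<le>Polynomial.degree F. Polynomial.coeff F i * (\<Sum>x\<in>S. c x * x ^ i))"
    by (subst sum.swap) (simp add: sum_distrib_left)
  also have "\<dots> = (\<Sum>i\<in>{0}. Polynomial.coeff F i * (\<Sum>x\<in>S. c x * x ^ i))"
    using moments F by (intro sum.mono_neutral_right) auto
  finally show ?thesis
    by (simp add: poly_0_coeff_0 mult.commute)
qed

text \<open>The polynomial with roots at all points of \<open>S\<close> except \<open>x\<close> has
  degree \<open>card S - 1\<close>, still within reach of the moments. If the total weight were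
  zero, its weighted sum, which is the single term at \<open>x\<close>, would vanish.\<close>

lemma sum_weights_nonzero:
  fixes c :: "'a::field \<Rightarrow> 'a"
  assumes S: "finite S" "x \<in> S" and c: "c x \<noteq> 0"
    and moments: "\<And>d. 0 < d \<Longrightarrow> d < card S \<Longrightarrow> (\<Sum>x\<in>S. c x * x ^ d) = 0"
  shows "(\<Sum>x\<in>S. c x) \<noteq> 0"
proof
  assume sum0: "(\<Sum>x\<in>S. c x) = 0"
  define F where "F = (\<Prod>y\<in>S - {x}. [:- y, 1:])"
  have "card S > 0"
    using S by (auto simp: card_gt_0_iff)
  hence deg: "Polynomial.degree F < card S"
    using S unfolding F_def degree_prod_root_factors by simp
  have "(\<Sum>y\<in>S. c y * poly F y) = (\<Sum>y\<in>{x}. c y * poly F y)"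
    using S by (intro sum.mono_neutral_right) (auto simp: F_def poly_prod)
  hence "c x * poly F x = 0"
    using sum_weights_poly[OF moments deg] sum0 by simp
  thus False
    using c S by (simp add: F_def poly_prod)
qed

section \<open>Divisibility, Frobenius and norms\<close>

lemma minus_1_dvd_power_minus_1: "(a::nat) - 1 dvd a ^ j - 1"
proof (induction j)
  case (Suc j)
  show ?case
  proof (cases "a = 0")
    case False
    have "a ^ Suc j - 1 = a * (a ^ j - 1) + (a - 1)"
      using False by (simp add: diff_mult_distrib2)
    thus ?thesis
      using Suc by simp
  qed simp
qed simp

lemma CHAR_eq_prime_base:
  assumes "prime p" "CARD('a::{field,finite}) = p ^ e"
  shows "CHAR('a) = p"
proof -
  have prime: "prime CHAR('a)"
    by (intro prime_CHAR_semidom finite_imp_CHAR_pos) simp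
  have "CHAR('a) dvd p ^ e"
    using CHAR_dvd_CARD[where 'a = 'a] assms(2) by simp
  hence "CHAR('a) dvd p"
    using prime prime_dvd_power by blast
  thus ?thesis
    using prime assms(1) primes_dvd_imp_eq by blast
qed

lemma power_diff_char_power:
  fixes x y :: "'a::{field,finite}"
  assumes "prime p" "CARD('a) = p ^ e"
  shows "(x - y) ^ (p ^ l) = x ^ (p ^ l) - y ^ (p ^ l)"
proof -
  \<comment> \<open>Additivity applied to \<open>(x - y) + y\<close> gives the difference rule
    without treating the sign of \<open>(-1) ^ (p ^ l)\<close>.\<close>
  have "(x - y + y) ^ (p ^ l) = (x - y) ^ (p ^ l) + y ^ (p ^ l)"
    by (rule freshmans_dream'[of _ l]) (use assms CHAR_eq_prime_base[OF assms] in auto)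
  thus ?thesis by simp
qed

lemma exists_power_neq_1:
  assumes "0 < n" "n + 1 < CARD('a::{field,finite})"
  shows "\<exists>x::'a. x \<noteq> 0 \<and> x ^ n \<noteq> 1"
proof (rule ccontr)
  assume "\<not> ?thesis"
  hence "UNIV - {0} \<subseteq> {x::'a. x ^ n = 1}" by auto
  hence "card (UNIV - {0::'a}) \<le> card {x::'a. x ^ n = 1}"
    by (intro card_mono) auto
  thus False
    using card_nth_roots_field_le[of n "1::'a"] assms by simp
qed

text \<open>The power \<open>x ^ (Q + 1)\<close> is the norm from the field of order
  \<open>Q^2\<close> to that of order \<open>Q\<close>. Its surjectivity onto the
  \<open>(Q - 1)\<close>-th roots of unity follows from the count of roots, taken with exponent
  \<open>Q + 1\<close>.\<close>

lemma exists_norm_preimage: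
  fixes c :: "'a::{field,finite}"
  assumes "(Q + 1) * (Q - 1) dvd CARD('a) - 1" "c ^ (Q - 1) = 1"
  shows "\<exists>x. x ^ (Q + 1) = c"
proof -
  obtain j where j: "(Q + 1) * ((Q - 1) * j) = CARD('a) - 1"
    using assms(1) by (metis dvdE mult.assoc)
  have "card {x. x ^ (Q + 1) = c} = Q + 1"
    by (rule card_nth_roots_field_eq[OF j]) (simp only: power_mult assms(2) power_one)
  thus ?thesis
    by (metis (mono_tags, lifting) Collect_empty_eq card.empty add_is_0 zero_neq_one)
qed

section \<open>Construction of the code and the choice of parameters\<close>

lemma exists_GRL_code_with_hull_dim:
  fixes S :: "'a::{field,finite} set" and c :: "'a \<Rightarrow> 'a"
  assumes p: "p > 0" and Q: "Q = p ^ l"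
    and norm: "(Q + 1) * (Q - 1) dvd CARD('a) - 1" and large: "Q + 2 < CARD('a)"
    and S: "0 \<notin> S" "card S = n" and c: "\<And>x. x \<in> S \<Longrightarrow> c x \<noteq> 0 \<and> c x ^ (Q - 1) = 1"
    and moments: "\<And>d. 0 < d \<Longrightarrow> d < n \<Longrightarrow> (\<Sum>x\<in>S. c x * x ^ d) = 0"
    and s: "1 \<le> s" "s + 1 \<le> k" and k: "k * (Q + 1) \<le> n + Q" and h: "h \<le> k - s - 1"
  shows "\<exists>C :: 'a vec set. is_GRL_code n s k C \<and> code_dim (n + s) (galois_hull p l (n + s) C) = h"
proof -
  have "(k - 1) * (Q + 1) + (Q + 1) \<le> n + Q"
    using k s by (cases k) auto
  \<comment> \<open>This is the degree bound for \<open>f * g ^ Q\<close> with both factors of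
    degree at most \<open>k - 1\<close>.\<close>
  hence k1: "(k - 1) * (Q + 1) < n" by simp
  have "k - 1 \<le> (k - 1) * (Q + 1)" by simp
  hence kn: "k \<le> n" using k1 by linarith
  obtain \<alpha> :: 'a where \<alpha>: "\<alpha> \<noteq> 0" "\<alpha> ^ (Q + 1) \<noteq> 1"
    using exists_power_neq_1[of "Q + 1", where 'a = 'a] large by auto
  define \<beta> where "\<beta> = \<alpha> ^ (Q + 1)"
  have "k - s - 1 - h \<le> card S"
    using S kn by simp
  \<comment> \<open>Together with the point 0 these form \<open>k - s - h\<close> evaluation
    conditions, leaving dimension \<open>h\<close> out of \<open>k - s\<close>.\<close>
  then obtain I where I: "I \<subseteq> S" "card I = k - s - 1 - h"
    using obtain_subset_with_card_n by metis
  have "\<forall>x\<in>S. \<exists>y. y ^ (Q + 1) = c x"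
    using exists_norm_preimage[OF norm] c by blast
  then obtain \<nu> where \<nu>: "\<And>x. x \<in> S \<Longrightarrow> \<nu> x ^ (Q + 1) = c x"
    by metis
  define w where "w x = (if x \<in> I then \<alpha> * \<nu> x else \<nu> x)" for x
  have w_nz: "w x \<noteq> 0" if "x \<in> S" for x
    using \<nu>[OF that] c[OF that] \<alpha> by (auto simp: w_def)
  \<comment> \<open>Scaling by \<alpha> on \<open>I\<close> changes the weight by a factor \<beta>
    different from 1, that is, by adding a nonzero multiple of \<open>c x\<close>.\<close>
  have w_norm: "w x ^ (Q + 1) = c x + (if x \<in> I then (\<beta> - 1) * c x else 0)" if "x \<in> S" for x
    unfolding w_def \<beta>_def \<nu>[OF that, symmetric] if_distrib[of "\<lambda>y. y ^ (Q + 1)"] power_mult_distrib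
    by (simp add: algebra_simps)
  define \<kappa> where "\<kappa> = (\<Sum>x\<in>S. c x)"
  have "S \<noteq> {}"
    using S(2) k1 by auto
  then obtain x0 where x0: "x0 \<in> S" by auto
  have "\<kappa> \<noteq> 0"
    unfolding \<kappa>_def using x0 c S moments by (intro sum_weights_nonzero[of S x0]) auto
  have weighted: "(\<Sum>x\<in>S. w x ^ (Q + 1) * poly F x) =
      \<kappa> * poly F 0 + (\<Sum>x\<in>I. (\<beta> - 1) * c x * poly F x)"
    if "Polynomial.degree F < n" for F
  proof -
    have "(\<Sum>x\<in>S. w x ^ (Q + 1) * poly F x) =
        (\<Sum>x\<in>S. c x * poly F x) + (\<Sum>x\<in>S. if x \<in> I then (\<beta> - 1) * c x * poly F x else 0)"
      unfolding sum.distrib[symmetric]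
    proof (rule sum.cong[OF refl])
      fix x assume "x \<in> S"
      show "w x ^ (Q + 1) * poly F x =
          c x * poly F x + (if x \<in> I then (\<beta> - 1) * c x * poly F x else 0)"
        unfolding w_norm[OF \<open>x \<in> S\<close>] by (simp add: distrib_right)
    qed
    also have "(\<Sum>x\<in>S. if x \<in> I then (\<beta> - 1) * c x * poly F x else 0) =
        (\<Sum>x\<in>I. (\<beta> - 1) * c x * poly F x)"
      using I by (simp add: Int_absorb1 flip: sum.inter_restrict)
    finally show ?thesis
      by (simp add: sum_weights_poly[OF moments that] \<kappa>_def)
  qed
  obtain b where b: "bij_betw b {..<n} S"
    using ex_bij_betw_nat_finite[of S] S by (auto simp: atLeast0LessThan)
  have bS: "b i \<in> S" if "i < n" for i
    using b that by (auto simp: bij_betw_def)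
  define a where "a = vec n b"
  define v where "v = vec n (\<lambda>i. w (b i))"
  \<comment> \<open>The case \<open>z = 0\<close> cannot clash with a point of \<open>I\<close>,
    since 0 is not in \<open>S\<close>.\<close>
  define d where "d z = (if z = 0 then \<kappa> else (\<beta> - 1) * c z)" for z
  have "0 \<notin> I" using I S by auto
  have inj: "inj_on (\<lambda>i. a $ i) {..<n}"
    using b by (auto simp: a_def bij_betw_def inj_on_def)
  have form: "(\<Sum>i<n. (v $ i) ^ (p ^ l + 1) * (poly f (a $ i) * poly g (a $ i) ^ (p ^ l))) =
      (\<Sum>z\<in>insert 0 I. d z * (poly f z * poly g z ^ (p ^ l)))"
    if fg: "Polynomial.degree f < k" "Polynomial.degree g < k" for f g
  proof -
    define F where "F = f * g ^ Q"
    have polyF: "poly F x = poly f x * poly g x ^ (p ^ l)" for x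
      by (simp add: F_def poly_power Q)
    have "Polynomial.degree F \<le> Polynomial.degree f + Polynomial.degree g * Q"
      unfolding F_def using degree_mult_le degree_power_le by (meson add_left_mono order.trans)
    also have "\<dots> \<le> (k - 1) + (k - 1) * Q"
      using fg by (intro add_mono mult_right_mono) auto
    also have "\<dots> < n"
      using k1 by simp
    finally have deg: "Polynomial.degree F < n" .
    have "(\<Sum>i<n. (v $ i) ^ (p ^ l + 1) * (poly f (a $ i) * poly g (a $ i) ^ (p ^ l))) =
        (\<Sum>i<n. w (b i) ^ (Q + 1) * poly F (b i))"
      by (rule sum.cong) (simp_all add: v_def a_def polyF Q)
    also have "\<dots> = (\<Sum>x\<in>S. w x ^ (Q + 1) * poly F x)"
      by (rule sum.reindex_bij_betw[OF b])
    also have "\<dots> = \<kappa> * poly F 0 + (\<Sum>x\<in>I. (\<beta> - 1) * c x * poly F x)"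
      by (rule weighted[OF deg])
    also have "(\<Sum>x\<in>I. (\<beta> - 1) * c x * poly F x) = (\<Sum>z\<in>I. d z * poly F z)"
      using \<open>0 \<notin> I\<close> by (intro sum.cong) (auto simp: d_def)
    also have "\<kappa> * poly F 0 + (\<Sum>z\<in>I. d z * poly F z) = (\<Sum>z\<in>insert 0 I. d z * poly F z)"
      using \<open>0 \<notin> I\<close> by (simp add: d_def)
    finally show ?thesis
      by (simp only: polyF)
  qed
  let ?C = "GRL_code k a v (1\<^sub>m s)"
  have "invertible_mat (1\<^sub>m s :: 'a mat)"
    by (auto simp: invertible_mat_def inverts_mat_def intro!: exI[of _ "1\<^sub>m s"])
  moreover have "\<forall>i<n. \<forall>j<n. i \<noteq> j \<longrightarrow> a $ i \<noteq> a $ j"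
    using inj by (auto simp: inj_on_def)
  moreover have "\<forall>i<n. v $ i \<noteq> 0"
    using w_nz bS by (auto simp: v_def)
  moreover have "a \<in> carrier_vec n" "v \<in> carrier_vec n" "(1\<^sub>m s :: 'a mat) \<in> carrier_mat s s"
    by (auto simp: a_def v_def)
  ultimately have "is_GRL_code n s k ?C"
    unfolding is_GRL_code_def using s kn add_leD1[OF s(2)] by blast
  moreover have "code_dim (n + s) (galois_hull p l (n + s) ?C) = h"
  proof (rule code_dim_galois_hull_GRL_one[where Z = "insert 0 I" and d = d])
    show "card (insert 0 I) + h = k - s"
      using \<open>0 \<notin> I\<close> I h s by simp
    show "d z \<noteq> 0" if "z \<in> insert 0 I" for z
      using that \<open>\<kappa> \<noteq> 0\<close> \<alpha> c I by (auto simp: d_def \<beta>_def)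
  qed (use p s kn inj form w_nz bS in \<open>auto simp: a_def v_def simp del: power_Suc sum.insert\<close>)
  ultimately show ?thesis by blast
qed

theorem mainTheorem12:
  fixes p e l r m t n s k h :: nat
    and Fp Fpl V :: "'a::{field,finite} set"
  assumes "prime p"
    and "CARD('a) = p ^ e"
    and "p ^ e > 4"
    and "l > 0"
    and "2 * l dvd e"
    and "subfield Fp (class_ring :: 'a ring)" and "card Fp = p"
    and "subfield Fpl (class_ring :: 'a ring)" and "card Fpl = p ^ l"
    and "V \<subseteq> Fpl"
    and "ring.dimension (class_ring :: 'a ring) r Fp V"
    and "r < l"
    and "m > 0"
    and "m dvd (p ^ e - 1) div (p ^ l - 1)"
    and "1 \<le> t" and "t \<le> p ^ (l - r) - 1"
    and "n = t * m * p ^ r"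
    and "s \<ge> 1"
    and "s + 1 \<le> k" and "k \<le> (n + p ^ l) div (p ^ l + 1)"
    and "h \<le> k - s - 1"
  shows "\<exists>C :: 'a vec set. is_GRL_code n s k C \<and> code_dim (n + s) (galois_hull p l (n + s) C) = h"
proof -
  define Q where "Q = p ^ l"
  have "p \<ge> 2"
    using \<open>prime p\<close> by (rule prime_ge_2_nat)
  hence "p ^ 1 \<le> p ^ l"
    using \<open>l > 0\<close> by (intro power_increasing) auto
  hence Q2: "Q \<ge> 2"
    using \<open>p \<ge> 2\<close> by (simp add: Q_def)
  \<comment> \<open>The factor 2 makes the field order a power of \<open>Q^2\<close>, so that
    \<open>Q^2 - 1\<close> divides it minus one and norm preimages exist.\<close>
  obtain j where j: "e = 2 * l * j"
    using \<open>2 * l dvd e\<close> by auto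
  have "j > 0"
    using j \<open>p ^ e > 4\<close> by (cases j) auto
  have q: "CARD('a) = (Q\<^sup>2) ^ j"
    using \<open>CARD('a) = p ^ e\<close> by (simp add: j Q_def power_mult power2_eq_square power_mult_distrib)
  have norm_eq: "(Q + 1) * (Q - 1) = Q\<^sup>2 - 1"
    by (simp add: power2_eq_square algebra_simps)
  have norm: "(Q + 1) * (Q - 1) dvd CARD('a) - 1"
    unfolding norm_eq q by (rule minus_1_dvd_power_minus_1)
  have "(Q\<^sup>2) ^ 1 \<le> (Q\<^sup>2) ^ j"
    using \<open>j > 0\<close> Q2 by (intro power_increasing) auto
  hence "Q * Q \<le> CARD('a)"
    by (simp add: q power2_eq_square)
  \<comment> \<open>For \<open>Q = 2\<close> the bound \<open>Q * Q\<close> only gives 4, so the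
    assumption that the field has more than 4 elements is what decides; for \<open>Q \<ge> 3\<close>
    the bound \<open>Q * Q\<close> suffices.\<close>
  have large: "Q + 2 < CARD('a)"
  proof (cases "Q = 2")
    case True
    then show ?thesis using \<open>p ^ e > 4\<close> \<open>CARD('a) = p ^ e\<close> by simp
  next
    case False
    hence "3 * Q \<le> Q * Q" using Q2 by simp
    then show ?thesis using \<open>Q * Q \<le> CARD('a)\<close> Q2 False by linarith
  qed
  \<comment> \<open>The bound on \<open>t\<close> ensures that \<open>t * p ^ r\<close> distinct
    elements can be chosen among the \<open>Q - 1\<close> nonzero elements of the subfield.\<close>
  have "t * p ^ r \<le> (p ^ (l - r) - 1) * p ^ r"
    using \<open>t \<le> p ^ (l - r) - 1\<close> by simp
  also have "\<dots> = p ^ l - p ^ r"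
    using \<open>r < l\<close> by (simp add: diff_mult_distrib flip: power_add)
  also have "\<dots> \<le> Q - 1"
    using \<open>p \<ge> 2\<close> by (simp add: Q_def diff_le_mono2)
  finally have N: "t * p ^ r \<le> Q - 1" .
  have dvd: "Q - 1 dvd CARD('a) - 1"
    using norm by (rule dvd_mult_right)
  have n: "n = m * (t * p ^ r)"
    using \<open>n = t * m * p ^ r\<close> by simp
  obtain S and c :: "'a \<Rightarrow> 'a" where S: "0 \<notin> S" "card S = n"
    and c: "\<And>x. x \<in> S \<Longrightarrow> c x ^ (Q - 1) = 1"
    and moments: "\<And>d. 0 < d \<Longrightarrow> d < n \<Longrightarrow> (\<Sum>x\<in>S. c x * x ^ d) = 0"
    using exists_points_with_subfield_weights[of Q m "t * p ^ r", where 'a = 'a, OF Q2 dvd _ _ N]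
      power_diff_char_power[OF \<open>prime p\<close> \<open>CARD('a) = p ^ e\<close>, where l = l]
      \<open>m dvd (p ^ e - 1) div (p ^ l - 1)\<close> \<open>CARD('a) = p ^ e\<close>
    unfolding n Q_def[symmetric] by metis
  show ?thesis
  proof (rule exists_GRL_code_with_hull_dim[OF _ Q_def norm large S _ moments \<open>s \<ge> 1\<close> \<open>s + 1 \<le> k\<close> _
        \<open>h \<le> k - s - 1\<close>])
    show "p > 0" using \<open>p \<ge> 2\<close> by simp
    show "k * (Q + 1) \<le> n + Q"
      using \<open>k \<le> (n + p ^ l) div (p ^ l + 1)\<close>
      by (simp add: Q_def less_eq_div_iff_mult_less_eq del: mult_Suc_right)
    show "c x \<noteq> 0 \<and> c x ^ (Q - 1) = 1" if "x \<in> S" for x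
      using c[OF that] Q2 by (auto simp: power_0_left)
  qed
qed

end
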